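(* Let $Q$ be a finite quandle. Then the enveloping group $G(Q)$ of $Q$ admits a faithful finite dimensional unitary group representation over $\mathbb{C}$.
   Context: A quandle is a set $Q$ with a binary operation $\triangleright$ such that: $x\triangleright x=x$ for all $x\in Q$; for all $x,y\in Q$ there is a unique $z\in Q$ with $x\triangleright z=y$; and $x\triangleright(y\triangleright z)=(x\triangleright y)\triangleright(x\triangleright z)$ for all $x,y,z\in Q$. The enveloping group of $Q$ is the group given by the presentation $G(Q)=\langle x\in Q \mid xyx^{-1}=x\triangleright y \text{ for } x,y\in Q\rangle$. *)

theory Defs
  imports "HOL-Algebra.Group" "Jordan_Normal_Form.Schur_Decomposition"
begin

section \<open>Quandles\<close>

locale quandle =
  fixes Q :: "'a set" and tri :: "'a \<Rightarrow> 'a \<Rightarrow> 'a" (infixr \<open>\<rhd>\<close> 70)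
  assumes closed: "\<lbrakk>x \<in> Q; y \<in> Q\<rbrakk> \<Longrightarrow> x \<rhd> y \<in> Q"
    and idem: "x \<in> Q \<Longrightarrow> x \<rhd> x = x"
    and unique_solution: "\<lbrakk>x \<in> Q; y \<in> Q\<rbrakk> \<Longrightarrow> \<exists>!z. z \<in> Q \<and> x \<rhd> z = y"
    and self_distrib:
      "\<lbrakk>x \<in> Q; y \<in> Q; z \<in> Q\<rbrakk> \<Longrightarrow> x \<rhd> (y \<rhd> z) = (x \<rhd> y) \<rhd> (x \<rhd> z)"

section \<open>Groups given by generators and relations\<close>

text \<open>A word is a list of letters; the letter \<open>(x, True)\<close> stands for the generator \<open>x\<close> and
  \<open>(x, False)\<close> for its formal inverse. A relation \<open>u = v\<close> is encoded as the pair \<open>(u, v)\<close>.\<close>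

type_synonym 'a word = "('a \<times> bool) list"

definition words :: "'a set \<Rightarrow> 'a word set"
  where "words S = lists (S \<times> UNIV)"

inductive_set pres_rel :: "'a set \<Rightarrow> ('a word \<times> 'a word) set \<Rightarrow> ('a word \<times> 'a word) set"
  for S R where
  refl: "w \<in> words S \<Longrightarrow> (w, w) \<in> pres_rel S R"
| sym: "(u, v) \<in> pres_rel S R \<Longrightarrow> (v, u) \<in> pres_rel S R"
| trans: "\<lbrakk>(u, v) \<in> pres_rel S R; (v, w) \<in> pres_rel S R\<rbrakk> \<Longrightarrow> (u, w) \<in> pres_rel S R"
| cancel: "\<lbrakk>u \<in> words S; v \<in> words S; x \<in> S\<rbrakk>
    \<Longrightarrow> (u @ [(x, b), (x, \<not> b)] @ v, u @ v) \<in> pres_rel S R"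
| relation: "\<lbrakk>(r, s) \<in> R; r \<in> words S; s \<in> words S; u \<in> words S; v \<in> words S\<rbrakk>
    \<Longrightarrow> (u @ r @ v, u @ s @ v) \<in> pres_rel S R"

definition presented_group :: "'a set \<Rightarrow> ('a word \<times> 'a word) set \<Rightarrow> 'a word set monoid"
  where "presented_group S R =
    \<lparr>carrier = words S // pres_rel S R,
     monoid.mult = (\<lambda>X Y. \<Union>u\<in>X. \<Union>v\<in>Y. pres_rel S R `` {u @ v}),
     one = pres_rel S R `` {[]}\<rparr>"

definition enveloping_group :: "'a set \<Rightarrow> ('a \<Rightarrow> 'a \<Rightarrow> 'a) \<Rightarrow> 'a word set monoid"
  where "enveloping_group Q tri =
    presented_group Q
      {([(x, True), (y, True), (x, False)], [(tri x y, True)]) | x y. x \<in> Q \<and> y \<in> Q}"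

section \<open>The unitary group\<close>

definition unitary_group :: "nat \<Rightarrow> complex mat monoid"
  where "unitary_group n =
    \<lparr>carrier = {A \<in> carrier_mat n n. A * mat_adjoint A = 1\<^sub>m n \<and> mat_adjoint A * A = 1\<^sub>m n},
     monoid.mult = (*),
     one = 1\<^sub>m n\<rparr>"

section \<open>Basic facts\<close>

lemma words_simps [simp]:
  "[] \<in> words S"
  "a # w \<in> words S \<longleftrightarrow> fst a \<in> S \<and> w \<in> words S"
  "u @ v \<in> words S \<longleftrightarrow> u \<in> words S \<and> v \<in> words S"
  by (auto simp: words_def mem_Times_iff)

lemma pres_rel_words: "(u, v) \<in> pres_rel S R \<Longrightarrow> u \<in> words S \<and> v \<in> words S"
  by (induction rule: pres_rel.induct) auto

lemma equiv_pres_rel: "equiv (words S) (pres_rel S R)"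
proof (rule equivI)
  show "pres_rel S R \<subseteq> words S \<times> words S"
    by (auto dest: pres_rel_words)
  show "refl_on (words S) (pres_rel S R)"
    by (simp add: refl_on_def pres_rel.refl)
  show "Relation.sym (pres_rel S R)"
    by (rule symI) (rule pres_rel.sym)
  show "Relation.trans (pres_rel S R)"
    by (rule transI) (rule pres_rel.trans)
qed

lemma pres_rel_context:
  assumes "(u, v) \<in> pres_rel S R" "p \<in> words S" "q \<in> words S"
  shows "(p @ u @ q, p @ v @ q) \<in> pres_rel S R"
  using assms
proof (induction rule: pres_rel.induct)
  case (refl w)
  then show ?case by (simp add: pres_rel.refl)
next
  case (sym u v)
  then show ?case by (simp add: pres_rel.sym)
next
  case (trans u v w)
  then show ?case by (metis pres_rel.trans)
next
  case (cancel u v x b)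
  then show ?case
    using pres_rel.cancel[of "p @ u" S "v @ q" x b R] by simp
next
  case (relation r s u v)
  then show ?case
    using pres_rel.relation[of r s R S "p @ u" "v @ q"] by simp
qed

lemma pres_rel_append:
  assumes "(u, u') \<in> pres_rel S R" "(v, v') \<in> pres_rel S R"
  shows "(u @ v, u' @ v') \<in> pres_rel S R"
proof (rule pres_rel.trans)
  show "(u @ v, u' @ v) \<in> pres_rel S R"
    using pres_rel_context[OF assms(1), of "[]" v] pres_rel_words[OF assms(2)] by simp
  show "(u' @ v, u' @ v') \<in> pres_rel S R"
    using pres_rel_context[OF assms(2), of u' "[]"] pres_rel_words[OF assms(1)] by simp
qed

lemma presented_group_mult:
  assumes "u \<in> words S" "v \<in> words S"
  shows "pres_rel S R `` {u} \<otimes>\<^bsub>presented_group S R\<^esub> pres_rel S R `` {v}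
    = pres_rel S R `` {u @ v}"
proof -
  have "congruent2 (pres_rel S R) (pres_rel S R) (\<lambda>u v. pres_rel S R `` {u @ v})"
    by (intro congruent2I' equiv_class_eq[OF equiv_pres_rel] pres_rel_append)
  from UN_equiv_class2[OF equiv_pres_rel equiv_pres_rel this assms]
  show ?thesis by (simp add: presented_group_def)
qed

definition inv_word :: "'a word \<Rightarrow> 'a word"
  where "inv_word w = rev (map (\<lambda>(x, b). (x, \<not> b)) w)"

lemma inv_word_words: "w \<in> words S \<Longrightarrow> inv_word w \<in> words S"
  by (auto simp: inv_word_def words_def)

lemma inv_word_cancel: "w \<in> words S \<Longrightarrow> (inv_word w @ w, []) \<in> pres_rel S R"
proof (induction w)
  case Nil
  then show ?case by (simp add: inv_word_def pres_rel.refl)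
next
  case (Cons a w)
  obtain x b where a: "a = (x, b)" by (cases a)
  have "(inv_word w @ [(x, \<not> b), (x, \<not> \<not> b)] @ w, inv_word w @ w) \<in> pres_rel S R"
    using Cons.prems a by (intro pres_rel.cancel) (auto intro: inv_word_words)
  moreover have "(inv_word w @ w, []) \<in> pres_rel S R"
    using Cons by simp
  ultimately have "(inv_word w @ [(x, \<not> b), (x, \<not> \<not> b)] @ w, []) \<in> pres_rel S R"
    by (rule pres_rel.trans)
  then show ?case
    by (simp add: a inv_word_def)
qed

lemma presented_group_is_group: "group (presented_group S R)"
proof (rule groupI)
  let ?G = "presented_group S R" and ?c = "\<lambda>w. pres_rel S R `` {w}"
  have carr: "carrier ?G = ?c ` words S"
    by (auto simp: presented_group_def quotient_def)
  have one: "\<one>\<^bsub>?G\<^esub> = ?c []"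
    by (simp add: presented_group_def)
  note simps = carr one presented_group_mult
  show "x \<otimes>\<^bsub>?G\<^esub> y \<in> carrier ?G" if "x \<in> carrier ?G" "y \<in> carrier ?G" for x y
    using that by (auto simp: simps)
  show "\<one>\<^bsub>?G\<^esub> \<in> carrier ?G"
    by (auto simp: simps)
  show "x \<otimes>\<^bsub>?G\<^esub> y \<otimes>\<^bsub>?G\<^esub> z = x \<otimes>\<^bsub>?G\<^esub> (y \<otimes>\<^bsub>?G\<^esub> z)"
    if "x \<in> carrier ?G" "y \<in> carrier ?G" "z \<in> carrier ?G" for x y z
    using that by (auto simp: simps)
  show "\<one>\<^bsub>?G\<^esub> \<otimes>\<^bsub>?G\<^esub> x = x" if "x \<in> carrier ?G" for x
    using that by (auto simp: simps)
  show "\<exists>y\<in>carrier ?G. y \<otimes>\<^bsub>?G\<^esub> x = \<one>\<^bsub>?G\<^esub>" if "x \<in> carrier ?G" for x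
  proof -
    from that obtain w where w: "w \<in> words S" "x = ?c w" by (auto simp: carr)
    have "?c (inv_word w) \<otimes>\<^bsub>?G\<^esub> x = \<one>\<^bsub>?G\<^esub>"
      using w by (simp add: simps inv_word_words equiv_class_eq[OF equiv_pres_rel inv_word_cancel])
    then show ?thesis using w by (auto simp: carr inv_word_words)
  qed
qed

text \<open>The universal property of a presentation.\<close>

definition eval_word :: "('g, 'm) monoid_scheme \<Rightarrow> ('a \<Rightarrow> 'g) \<Rightarrow> 'a word \<Rightarrow> 'g"
  where "eval_word H f w =
    foldr (\<lambda>(x, b) h. (if b then f x else inv\<^bsub>H\<^esub> f x) \<otimes>\<^bsub>H\<^esub> h) w \<one>\<^bsub>H\<^esub>"

lemma (in group) eval_word_closed:
  assumes "f \<in> S \<rightarrow> carrier G" "w \<in> words S"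
  shows "eval_word G f w \<in> carrier G"
  using assms(2)
  by (induction w) (use assms(1) in \<open>auto simp: eval_word_def Pi_iff split: prod.splits\<close>)

lemma (in group) eval_word_append:
  assumes "f \<in> S \<rightarrow> carrier G" "u \<in> words S" "v \<in> words S"
  shows "eval_word G f (u @ v) = eval_word G f u \<otimes> eval_word G f v"
  using assms(2)
proof (induction u)
  case Nil
  then show ?case using eval_word_closed[OF assms(1,3)] by (simp add: eval_word_def)
next
  case (Cons a u)
  obtain x b where a: "a = (x, b)" by (cases a)
  have cons: "eval_word G f (a # w) = (if b then f x else inv f x) \<otimes> eval_word G f w" for w
    by (simp add: eval_word_def a)
  have "f x \<in> carrier G" using Cons.prems a assms(1) by auto
  then show ?case
    using Cons eval_word_closed[OF assms(1)] assms(3) by (simp add: cons m_assoc)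
qed

lemma (in group) eval_word_pres_rel:
  assumes f: "f \<in> S \<rightarrow> carrier G"
    and R: "\<And>r s. \<lbrakk>(r, s) \<in> R; r \<in> words S; s \<in> words S\<rbrakk> \<Longrightarrow> eval_word G f r = eval_word G f s"
    and uv: "(u, v) \<in> pres_rel S R"
  shows "eval_word G f u = eval_word G f v"
  using uv
proof (induction rule: pres_rel.induct)
  case (cancel u v x b)
  have "f x \<in> carrier G" using cancel f by auto
  then have "eval_word G f [(x, b), (x, \<not> b)] = \<one>"
    by (simp add: eval_word_def)
  then show ?case
    using cancel eval_word_closed[OF f]
      eval_word_append[OF f, of u "[(x, b), (x, \<not> b)] @ v"]
      eval_word_append[OF f, of "[(x, b), (x, \<not> b)]" v] eval_word_append[OF f, of u v]
    by simp
next
  case (relation r s u v)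
  then show ?case
    using R by (simp add: eval_word_append[OF f])
qed auto

theorem (in group) presented_group_universal:
  assumes f: "f \<in> S \<rightarrow> carrier G"
    and R: "\<And>r s. \<lbrakk>(r, s) \<in> R; r \<in> words S; s \<in> words S\<rbrakk> \<Longrightarrow> eval_word G f r = eval_word G f s"
  shows "\<exists>h \<in> hom (presented_group S R) G.
    \<forall>w \<in> words S. h (pres_rel S R `` {w}) = eval_word G f w"
proof -
  let ?c = "\<lambda>w. pres_rel S R `` {w}"
  let ?h = "\<lambda>X. THE g. g \<in> eval_word G f ` X"
  have h: "?h (?c w) = eval_word G f w" if "w \<in> words S" for w
  proof (rule the_equality)
    show "eval_word G f w \<in> eval_word G f ` ?c w"
      using that by (auto intro: pres_rel.refl)
    show "g = eval_word G f w" if "g \<in> eval_word G f ` ?c w" for g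
      using that eval_word_pres_rel[OF f R] by force
  qed
  have carr: "carrier (presented_group S R) = ?c ` words S"
    by (auto simp: presented_group_def quotient_def)
  have "?h \<in> hom (presented_group S R) G"
    by (rule homI)
      (auto simp: carr presented_group_mult h eval_word_append[OF f] eval_word_closed[OF f])
  show ?thesis
    by (rule bexI[of _ ?h]) (use h \<open>?h \<in> hom (presented_group S R) G\<close> in simp_all)
qed

lemma mat_adjoint_dims [simp]:
  "dim_row (mat_adjoint A) = dim_col A" "dim_col (mat_adjoint A) = dim_row A"
  by (auto simp: mat_adjoint_def)

lemma mat_adjoint_index [simp]:
  "\<lbrakk>i < dim_col A; j < dim_row A\<rbrakk> \<Longrightarrow> mat_adjoint A $$ (i, j) = conjugate (A $$ (j, i))"
  by (simp add: mat_adjoint_def mat_of_rows_def)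

lemma mat_adjoint_mult:
  fixes A B :: "complex mat"
  assumes "A \<in> carrier_mat n n" "B \<in> carrier_mat n n"
  shows "mat_adjoint (A * B) = mat_adjoint B * mat_adjoint A"
  using assms by (intro eq_matI) (auto simp: scalar_prod_def mult.commute)

lemma unitary_group_is_group: "group (unitary_group n)"
proof (rule groupI)
  let ?U = "unitary_group n"
  have adj: "mat_adjoint A \<in> carrier_mat n n" if "A \<in> carrier_mat n n" for A :: "complex mat"
    using that by auto
  have adj_adj: "mat_adjoint (mat_adjoint A) = A" for A :: "complex mat"
    by (intro eq_matI) auto
  show "x \<otimes>\<^bsub>?U\<^esub> y \<in> carrier ?U" if "x \<in> carrier ?U" "y \<in> carrier ?U" for x y
  proof -
    from that have x: "x \<in> carrier_mat n n" "x * mat_adjoint x = 1\<^sub>m n" "mat_adjoint x * x = 1\<^sub>m n"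
      and y: "y \<in> carrier_mat n n" "y * mat_adjoint y = 1\<^sub>m n" "mat_adjoint y * y = 1\<^sub>m n"
      by (auto simp: unitary_group_def)
    note c = x(1) y(1) adj[OF x(1)] adj[OF y(1)]
    have "(x * y) * (mat_adjoint y * mat_adjoint x) = x * ((y * mat_adjoint y) * mat_adjoint x)"
      using c by (simp add: assoc_mult_mat[of _ n n _ n _ n])
    moreover have "(mat_adjoint y * mat_adjoint x) * (x * y) = mat_adjoint y * ((mat_adjoint x * x) * y)"
      using c by (simp add: assoc_mult_mat[of _ n n _ n _ n])
    ultimately show ?thesis
      using c x y by (simp add: unitary_group_def mat_adjoint_mult[of _ n])
  qed
  show "\<one>\<^bsub>?U\<^esub> \<in> carrier ?U"
  proof -
    have "mat_adjoint (1\<^sub>m n) = (1\<^sub>m n :: complex mat)"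
      by (intro eq_matI) auto
    then show ?thesis by (simp add: unitary_group_def)
  qed
  show "x \<otimes>\<^bsub>?U\<^esub> y \<otimes>\<^bsub>?U\<^esub> z = x \<otimes>\<^bsub>?U\<^esub> (y \<otimes>\<^bsub>?U\<^esub> z)"
    if "x \<in> carrier ?U" "y \<in> carrier ?U" "z \<in> carrier ?U" for x y z
    using that by (auto simp: unitary_group_def intro: assoc_mult_mat)
  show "\<one>\<^bsub>?U\<^esub> \<otimes>\<^bsub>?U\<^esub> x = x" if "x \<in> carrier ?U" for x
    using that by (auto simp: unitary_group_def)
  show "\<exists>y\<in>carrier ?U. y \<otimes>\<^bsub>?U\<^esub> x = \<one>\<^bsub>?U\<^esub>" if "x \<in> carrier ?U" for x
    using that by (intro bexI[of _ "mat_adjoint x"]) (auto simp: unitary_group_def adj_adj)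
qed

end

theory Submission
  imports Defs "HOL-Algebra.Elementary_Groups" "HOL-Combinatorics.Cycles"
    "HOL-Analysis.Continuum_Not_Denumerable"
begin

text \<open>Choose \<open>N > 0\<close> such that the \<open>N\<close>-th power of every left translation of \<open>Q\<close> is the identity.
  Then \<open>x\<^sup>N\<close> is central in \<open>G = G(Q)\<close> and depends only on the orbit of \<open>x\<close>, so \<open>x \<mapsto> x\<^sup>N\<close> extends to
  a homomorphism \<open>\<psi>\<close> from \<open>G\<close> onto a central subgroup \<open>A\<close>. The quotient \<open>G/A\<close> is finite by
  Dietzmann's lemma: it is generated by a finite set of torsion elements closed under conjugation.
  For a central element \<open>t\<close> let \<open>d\<^sub>t(g)\<close> be the exponent sum in \<open>g\<close> of those generators \<open>x\<close> with
  \<open>x\<^sup>N = t\<close>. Then \<open>\<psi>(g)\<close> is the product of the \<open>t\<close> to the power \<open>d\<^sub>t(g)\<close>, and \<open>d\<^sub>t(\<psi>(g)) = N d\<^sub>t(g)\<close>.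
  Hence an element \<open>\<psi>(g)\<close> of \<open>A\<close> all of whose degrees vanish is trivial, that is, \<open>G\<close> embeds
  into the product of the finite group \<open>G/A\<close> and a free abelian group of finite rank. The former acts
  on its regular representation, the latter by characters \<open>k \<mapsto> exp(2\<pi>i\<alpha>k)\<close> with \<open>\<alpha>\<close> irrational.\<close>

section \<open>Monomial unitary representations\<close>

text \<open>The matrix of \<open>g\<close> sends the basis vector at \<open>x\<close> to
  \<open>c g x\<close> times the basis vector at \<open>act g x\<close>. The cocycle identity
  \<open>c_mult\<close> makes this multiplicative in \<open>g\<close>, and \<open>c_norm\<close>
  makes the matrices unitary.\<close>

lemma (in group) monomial_unitary_rep:
  fixes X :: "'x set" and act :: "'a \<Rightarrow> 'x \<Rightarrow> 'x" and c :: "'a \<Rightarrow> 'x \<Rightarrow> complex"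
  assumes fin: "finite X"
    and act_closed: "\<And>g x. \<lbrakk>g \<in> carrier G; x \<in> X\<rbrakk> \<Longrightarrow> act g x \<in> X"
    and act_one: "\<And>x. x \<in> X \<Longrightarrow> act \<one> x = x"
    and act_mult: "\<And>g h x. \<lbrakk>g \<in> carrier G; h \<in> carrier G; x \<in> X\<rbrakk>
      \<Longrightarrow> act (g \<otimes> h) x = act g (act h x)"
    and c_norm: "\<And>g x. \<lbrakk>g \<in> carrier G; x \<in> X\<rbrakk> \<Longrightarrow> norm (c g x) = 1"
    and c_mult: "\<And>g h x. \<lbrakk>g \<in> carrier G; h \<in> carrier G; x \<in> X\<rbrakk>
      \<Longrightarrow> c (g \<otimes> h) x = c g (act h x) * c h x"
    and faithful: "\<And>g. \<lbrakk>g \<in> carrier G; \<And>x. x \<in> X \<Longrightarrow> act g x = x \<and> c g x = 1\<rbrakk> \<Longrightarrow> g = \<one>"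
  shows "\<exists>n. \<exists>\<rho> \<in> hom G (unitary_group n). inj_on \<rho> (carrier G)"
proof -
  obtain b where b: "bij_betw b {0..<card X} X"
    using fin ex_bij_betw_nat_finite by blast
  define n where "n = card X"
  have bX: "b i \<in> X" if "i < n" for i
    using b that by (auto simp: bij_betw_def n_def)
  have b_inj: "b i = b j \<longleftrightarrow> i = j" if "i < n" "j < n" for i j
    using b that by (auto simp: bij_betw_def n_def inj_on_def)
  have b_surj: "\<exists>i<n. b i = x" if "x \<in> X" for x
    using b that unfolding bij_betw_def n_def by (metis atLeastLessThan_iff imageE)
  define R where
    "R g = mat n n (\<lambda>(i, j). if b i = act g (b j) then c g (b j) else 0)" for g
  have R_carrier: "R g \<in> carrier_mat n n" for g
    by (simp add: R_def)
  have R_mult: "R (g \<otimes> h) = R g * R h" if g: "g \<in> carrier G" and h: "h \<in> carrier G" for g h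
  proof (rule eq_matI)
    fix i j assume "i < dim_row (R g * R h)" "j < dim_col (R g * R h)"
    then have i: "i < n" and j: "j < n" by (auto simp: R_def)
    let ?y = "act h (b j)"
    let ?v = "if b i = act g ?y then c g ?y * c h (b j) else 0"
    have y: "?y \<in> X" using act_closed h bX j by blast
    have "(R g * R h) $$ (i, j) = (\<Sum>k\<in>{0..<n}. R g $$ (i, k) * R h $$ (k, j))"
      using i j by (simp add: R_def scalar_prod_def)
    \<comment> \<open>Column \<open>j\<close> of \<open>R h\<close> has a single nonzero entry, in
      the row of \<open>?y\<close>, so one term survives. As \<open>?v\<close> does not depend on
      \<open>k\<close>, the sum can be moved from indices to points of \<open>X\<close>.\<close>
    also have "\<dots> = (\<Sum>k\<in>{0..<n}. if b k = ?y then ?v else 0)"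
      using i j by (intro sum.cong) (auto simp: R_def)
    also have "\<dots> = (\<Sum>x\<in>X. if x = ?y then ?v else 0)"
      using b unfolding n_def by (rule sum.reindex_bij_betw)
    also have "\<dots> = ?v" using fin y by simp
    also have "\<dots> = R (g \<otimes> h) $$ (i, j)"
      using i j g h bX by (simp add: R_def act_mult c_mult)
    finally show "R (g \<otimes> h) $$ (i, j) = (R g * R h) $$ (i, j)" ..
  qed (auto simp: R_def)
  have c_one: "c \<one> x = 1" if "x \<in> X" for x
  proof -
    have "c \<one> x = c \<one> x * c \<one> x" using c_mult[of \<one> \<one> x] that by (simp add: act_one)
    moreover have "c \<one> x \<noteq> 0" using c_norm[of \<one> x] that by auto
    ultimately show ?thesis by simp
  qed
  have R_one: "R \<one> = 1\<^sub>m n"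
    by (rule eq_matI) (auto simp: R_def act_one c_one bX b_inj)
  have R_inv: "mat_adjoint (R g) = R (inv g)" if g: "g \<in> carrier G" for g
  proof (rule eq_matI)
    fix i j assume "i < dim_row (R (inv g))" "j < dim_col (R (inv g))"
    then have i: "i < n" and j: "j < n" by (auto simp: R_def)
    have iff: "b j = act g (b i) \<longleftrightarrow> b i = act (inv g) (b j)"
      using act_mult[of g "inv g" "b j"] act_mult[of "inv g" g "b i"] g bX i j
      by (auto simp: act_one)
    have "cnj (c g (b i)) = c (inv g) (b j)" if "b j = act g (b i)"
    proof -
      \<comment> \<open>Since \<open>c g (b i)\<close> has modulus one, its conjugate and
        \<open>c (inv g) (b j)\<close> are both inverse to it.\<close>
      have "c (inv g) (b j) * c g (b i) = 1"
        using c_mult[of "inv g" g "b i"] g bX i that by (simp add: c_one)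
      moreover have "cnj (c g (b i)) * c g (b i) = 1"
        using c_norm[of g "b i"] g bX i by (metis complex_norm_square mult.commute of_real_1 one_power2)
      moreover have "c g (b i) \<noteq> 0" using c_norm[of g "b i"] g bX i by auto
      ultimately show ?thesis by (metis mult_right_cancel)
    qed
    then show "mat_adjoint (R g) $$ (i, j) = R (inv g) $$ (i, j)"
      using i j iff by (simp add: R_def)
  qed (auto simp: R_def)
  have hom: "R \<in> hom G (unitary_group n)"
    by (rule homI) (auto simp: unitary_group_def R_carrier R_inv R_mult R_one simp flip: R_mult)
  interpret group_hom G "unitary_group n" R
    by (rule group_hom.intro[OF is_group unitary_group_is_group group_hom_axioms.intro[OF hom]])
  have "inj_on R (carrier G)"
    unfolding inj_on_one_iff
  proof (intro allI impI)
    fix g assume g: "g \<in> carrier G" and "R g = \<one>\<^bsub>unitary_group n\<^esub>"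
    then have 1: "R g = 1\<^sub>m n" by (simp add: unitary_group_def)
    show "g = \<one>"
    proof (rule faithful[OF g])
      fix x assume x: "x \<in> X"
      then obtain j where j: "j < n" "b j = x" using b_surj by blast
      have "R g $$ (j, j) = 1" using j by (simp add: 1)
      then show "act g x = x \<and> c g x = 1"
        using j by (simp add: R_def split: if_splits)
    qed
  qed
  with hom show ?thesis by blast
qed

section \<open>Faithfulness from a finite quotient and integer degrees\<close>

lemma exists_irrational: "\<exists>x::real. x \<notin> \<rat>"
  using uncountable_UNIV_real countable_rat by (metis UNIV_eq_I)

text \<open>On the points \<open>(h, i)\<close> the group acts through \<phi> by left translation of
  \<open>h\<close>, with coefficient the character of angle 2 pi \<alpha> \<open>d i g\<close>. As
  \<alpha> is irrational, this character is 1 only where \<open>d i\<close> vanishes, so one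
  \<alpha> serves all \<open>i\<close>.\<close>

lemma (in group) unitary_rep_of_finite_quotient_and_degrees:
  fixes H :: "('h, 'm) monoid_scheme" and d :: "'i \<Rightarrow> 'a \<Rightarrow> int"
  assumes H: "group H" "finite (carrier H)" and \<phi>: "\<phi> \<in> hom G H"
    and I: "finite I" "I \<noteq> {}"
    and d: "\<And>i. i \<in> I \<Longrightarrow> d i \<in> hom G integer_group"
    and ker: "\<And>g. \<lbrakk>g \<in> carrier G; \<phi> g = \<one>\<^bsub>H\<^esub>; \<And>i. i \<in> I \<Longrightarrow> d i g = 0\<rbrakk> \<Longrightarrow> g = \<one>"
  shows "\<exists>n. \<exists>\<rho> \<in> hom G (unitary_group n). inj_on \<rho> (carrier G)"
proof -
  interpret H: group H by (rule H(1))
  interpret group_hom G H \<phi> by unfold_locales (rule \<phi>)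
  obtain \<alpha> :: real where \<alpha>: "\<alpha> \<notin> \<rat>" using exists_irrational by blast
  have cis_1: "k = 0" if "cis (2 * pi * \<alpha> * real_of_int k) = 1" for k
  proof (rule ccontr)
    assume k: "k \<noteq> 0"
    from that have "cos (2 * pi * \<alpha> * real_of_int k) = 1" by (simp add: complex_eq_iff)
    then obtain m :: int where "2 * pi * \<alpha> * real_of_int k = real_of_int m * 2 * pi"
      unfolding cos_one_2pi_int by blast
    then have "\<alpha> = real_of_int m / real_of_int k" using k by (simp add: field_simps)
    then show False using \<alpha> by simp
  qed
  have d_mult: "d i (g \<otimes> h) = d i g + d i h"
    if "i \<in> I" "g \<in> carrier G" "h \<in> carrier G" for i g h
    using d[of i] that by (simp add: hom_def)
  show ?thesis
  proof (rule monomial_unitary_rep[where X = "carrier H \<times> I" and act = "\<lambda>g (h, i). (\<phi> g \<otimes>\<^bsub>H\<^esub> h, i)"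
        and c = "\<lambda>g (h, i). cis (2 * pi * \<alpha> * real_of_int (d i g))"])
    fix g assume g: "g \<in> carrier G"
      and triv: "\<And>x. x \<in> carrier H \<times> I \<Longrightarrow> (case x of (h, i) \<Rightarrow> (\<phi> g \<otimes>\<^bsub>H\<^esub> h, i)) = x \<and>
        (case x of (h, i) \<Rightarrow> cis (2 * pi * \<alpha> * real_of_int (d i g))) = 1"
    show "g = \<one>"
    proof (rule ker[OF g])
      \<comment> \<open>Some point over an index is needed to read off \<open>\<phi> g\<close>; this
        is where \<open>I \<noteq> {}\<close> enters.\<close>
      obtain i where "i \<in> I" using I by blast
      then show "\<phi> g = \<one>\<^bsub>H\<^esub>" using triv[of "(\<one>\<^bsub>H\<^esub>, i)"] g by simp
      show "d i g = 0" if "i \<in> I" for i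
        using triv[of "(\<one>\<^bsub>H\<^esub>, i)"] that cis_1 by simp
    qed
  qed (use H I in \<open>auto simp: d_mult H.m_assoc cis_mult algebra_simps\<close>)
qed

section \<open>Dietzmann's lemma\<close>

lemma (in monoid) nat_pow_comm_self:
  "x \<in> carrier G \<Longrightarrow> x \<otimes> x [^] (n::nat) = x [^] n \<otimes> x"
  by (metis nat_pow_Suc nat_pow_Suc2)

text \<open>By s t = (s t s^-1) s, an \<open>s\<close> passes a letter to its right at the cost of
  conjugating it, and the conjugate is again in \<open>S\<close>. So all occurrences of
  \<open>s\<close> can be moved to the right end without gaining or losing letters.\<close>

lemma (in group) list_conj_collect:
  assumes conj: "\<And>s t. \<lbrakk>s \<in> S; t \<in> S\<rbrakk> \<Longrightarrow> s \<otimes> t \<otimes> inv s \<in> S"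
    and S: "S \<subseteq> carrier G" and s: "s \<in> S" and w: "set w \<subseteq> S"
  shows "\<exists>w'. set w' \<subseteq> S \<and> length w' + count_list w s = length w \<and>
    foldr (\<otimes>) w \<one> = foldr (\<otimes>) w' \<one> \<otimes> s [^] count_list w s"
  using w
proof (induction w)
  case Nil
  then show ?case by simp
next
  have closed: "foldr (\<otimes>) v \<one> \<in> carrier G" if "set v \<subseteq> S" for v
    using that S by (induction v) auto
  have sc: "s \<in> carrier G" using S s by blast
  case (Cons a w)
  then obtain w' where w': "set w' \<subseteq> S" "length w' + count_list w s = length w"
    "foldr (\<otimes>) w \<one> = foldr (\<otimes>) w' \<one> \<otimes> s [^] count_list w s" by auto
  have a: "a \<in> S" "a \<in> carrier G" using Cons.prems S by auto
  show ?case
  proof (cases "a = s")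
    case True
    let ?v = "map (\<lambda>t. s \<otimes> t \<otimes> inv s) w'"
    have push: "s \<otimes> foldr (\<otimes>) u \<one> = foldr (\<otimes>) (map (\<lambda>t. s \<otimes> t \<otimes> inv s) u) \<one> \<otimes> s"
      if "set u \<subseteq> S" for u
      using that
    proof (induction u)
      case Nil
      then show ?case using sc by simp
    next
      case (Cons t u)
      have t: "t \<in> carrier G" and u: "set u \<subseteq> S" using Cons.prems S by auto
      have cu: "foldr (\<otimes>) (map (\<lambda>t. s \<otimes> t \<otimes> inv s) u) \<one> \<in> carrier G"
        using u s conj by (intro closed) auto
      have "s \<otimes> (t \<otimes> foldr (\<otimes>) u \<one>) = s \<otimes> t \<otimes> inv s \<otimes> (s \<otimes> foldr (\<otimes>) u \<one>)"
        using sc t closed[OF u] m_assoc[of "inv s" s "foldr (\<otimes>) u \<one>"] by (simp add: m_assoc)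
      then show ?case using Cons.IH[OF u] sc t cu by (simp add: m_assoc)
    qed
    have v: "set ?v \<subseteq> S" using w' s conj by auto
    have "s \<otimes> foldr (\<otimes>) w \<one> = foldr (\<otimes>) ?v \<one> \<otimes> s \<otimes> s [^] count_list w s"
      using w' push[OF w'(1)] closed[OF w'(1)] sc by (simp flip: m_assoc)
    also have "\<dots> = foldr (\<otimes>) ?v \<one> \<otimes> s [^] Suc (count_list w s)"
      using closed[OF v] sc by (simp add: m_assoc nat_pow_comm_self)
    finally show ?thesis using True v w'(2) by (intro exI[of _ ?v]) simp
  next
    case False
    have "a \<otimes> foldr (\<otimes>) w \<one> = a \<otimes> foldr (\<otimes>) w' \<one> \<otimes> s [^] count_list w s"
      using w'(3) a closed[OF w'(1)] sc by (simp add: m_assoc)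
    then show ?thesis using False w' a by (intro exI[of _ "a # w'"]) simp
  qed
qed

text \<open>By \<open>list_conj_collect\<close> a word in which some letter occurs \<open>N\<close> times can be shortened by \<open>N\<close>
  letters, so words of length at most \<open>card S * N\<close> represent all elements.\<close>

lemma (in group) dietzmann:
  assumes conj: "\<And>s t. \<lbrakk>s \<in> S; t \<in> S\<rbrakk> \<Longrightarrow> s \<otimes> t \<otimes> inv s \<in> S"
    and S: "S \<subseteq> carrier G" "finite S" and N: "N > 0" "\<And>s. s \<in> S \<Longrightarrow> s [^] (N::nat) = \<one>"
    and gen: "generate G S = carrier G"
  shows "finite (carrier G)"
proof -
  let ?p = "\<lambda>w. foldr (\<otimes>) w \<one>"
  have closed: "?p v \<in> carrier G" if "set v \<subseteq> S" for v
    using that S by (induction v) auto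
  have append: "?p (u @ v) = ?p u \<otimes> ?p v" if "set u \<subseteq> S" "set v \<subseteq> S" for u v
    using that S closed by (induction u) (auto simp: m_assoc)
  have replicate: "?p (replicate k s) = s [^] k" if "s \<in> S" for s k
    using subsetD[OF S(1) that] by (induction k) (simp_all add: nat_pow_comm_self)
  have word: "\<exists>w. set w \<subseteq> S \<and> ?p w = g" if "g \<in> generate G S" for g
    using that
  proof (induction rule: generate.induct)
    case one
    show ?case by (intro exI[of _ "[]"]) simp
  next
    case (incl s)
    then show ?case using S by (intro exI[of _ "[s]"]) auto
  next
    case (inv s)
    then have s: "s \<in> carrier G" using S by auto
    \<comment> \<open>Torsion turns inverses into positive powers, so words without formal inverses
      suffice.\<close>
    have "s [^] (N - 1) \<otimes> s = \<one>" using N inv by (metis Suc_diff_1 nat_pow_Suc)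
    then have "inv s = s [^] (N - 1)" using s by (metis inv_equality nat_pow_closed)
    then show ?case using inv by (intro exI[of _ "replicate (N - 1) s"]) (simp add: replicate set_replicate_conv_if del: foldr_replicate)
  next
    case (eng g h)
    then obtain u v where "set u \<subseteq> S" "?p u = g" "set v \<subseteq> S" "?p v = h" by blast
    then show ?case by (intro exI[of _ "u @ v"]) (simp add: append del: foldr_append)
  qed
  have short: "\<exists>v. set v \<subseteq> S \<and> length v \<le> card S * N \<and> ?p v = ?p w" if "set w \<subseteq> S" for w
    using that
  proof (induction "length w" arbitrary: w rule: less_induct)
    case less
    show ?case
    proof (cases "length w \<le> card S * N")
      case True
      then show ?thesis using less.prems by blast
    next
      case False
      \<comment> \<open>Pigeonhole: the counts of the elements of \<open>S\<close> add up to the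
        length, which exceeds \<open>card S * N\<close>.\<close>
      have "\<exists>s\<in>S. N \<le> count_list w s"
      proof (rule ccontr)
        assume "\<not> ?thesis"
        then have "sum (count_list w) S \<le> card S * N"
          by (intro sum_bounded_above[of S _ N, simplified]) (auto simp: not_le)
        then show False using sum_count_set[OF less.prems S(2)] False by simp
      qed
      then obtain s where s: "s \<in> S" "N \<le> count_list w s" by blast
      obtain w' where w': "set w' \<subseteq> S" "length w' + count_list w s = length w"
        "?p w = ?p w' \<otimes> s [^] count_list w s"
        using list_conj_collect[OF conj S(1) s(1) less.prems] by blast
      let ?v = "w' @ replicate (count_list w s - N) s"
      have sc: "s \<in> carrier G" using s S by auto
      have v: "set ?v \<subseteq> S" using w' s by auto
      have "s [^] count_list w s = s [^] (N + (count_list w s - N))" using s by simp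
      also have "\<dots> = s [^] (count_list w s - N)"
        using sc N(2)[OF s(1)] by (simp flip: nat_pow_mult)
      finally have "s [^] count_list w s = s [^] (count_list w s - N)" .
      moreover have "?p ?v = ?p w' \<otimes> ?p (replicate (count_list w s - N) s)"
        using w'(1) v by (intro append) auto
      ultimately have "?p ?v = ?p w"
        using w'(3) replicate[OF s(1)] by (simp del: foldr_append foldr_replicate)
      moreover have "length ?v < length w" using w' s N by simp
      ultimately show ?thesis using less.hyps v by metis
    qed
  qed
  have "carrier G \<subseteq> ?p ` {w. set w \<subseteq> S \<and> length w \<le> card S * N}"
  proof
    fix g assume "g \<in> carrier G"
    then obtain w where w: "set w \<subseteq> S" "?p w = g" using word gen by blast
    obtain v where v: "set v \<subseteq> S" "length v \<le> card S * N" "?p v = ?p w"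
      using short[OF w(1)] by blast
    show "g \<in> ?p ` {w. set w \<subseteq> S \<and> length w \<le> card S * N}"
      by (rule image_eqI[of _ _ v]) (use v w in simp_all)
  qed
  then show ?thesis using finite_lists_length_le[OF S(2)] finite_surj by blast
qed

section \<open>Words and presented groups\<close>

text \<open>In a commutative group the letters of a word can be sorted by their value under
  \<open>f\<close>. The exponent sum over the letters with value \<open>t\<close> is written as an
  evaluation in \<open>integer_group\<close>, to match the homomorphisms that a presentation
  provides.\<close>

lemma (in comm_group) eval_word_eq_finprod:
  assumes S: "finite S" and f: "f \<in> S \<rightarrow> carrier G" and w: "w \<in> words S"
  shows "eval_word G f w =
    (\<Otimes>t\<in>f ` S. t [^] eval_word integer_group (\<lambda>x. of_bool (f x = t)) w)"
  using w
proof (induction w)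
  case Nil
  then show ?case by (simp add: eval_word_def)
next
  case (Cons a w)
  obtain x b where a: "a = (x, b)" by (cases a)
  have x: "x \<in> S" "f x \<in> carrier G" using Cons.prems f a by auto
  let ?d = "\<lambda>t. eval_word integer_group (\<lambda>x. of_bool (f x = t)) w"
  let ?s = "if b then 1 else - 1 :: int"
  have carr: "t \<in> carrier G" if "t \<in> f ` S" for t using that f by auto
  have deg: "eval_word integer_group (\<lambda>x. of_bool (f x = t)) (a # w)
      = (if f x = t then ?s else 0) + ?d t" for t
    by (simp add: eval_word_def a)
  have "(\<Otimes>t\<in>f ` S. t [^] eval_word integer_group (\<lambda>x. of_bool (f x = t)) (a # w))
      = (\<Otimes>t\<in>f ` S. (if f x = t then t [^] ?s else \<one>) \<otimes> t [^] ?d t)"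
    unfolding deg using carr by (intro finprod_cong) (auto simp: int_pow_mult simp_implies_def)
  also have "\<dots> = (\<Otimes>t\<in>f ` S. if f x = t then t [^] ?s else \<one>) \<otimes> (\<Otimes>t\<in>f ` S. t [^] ?d t)"
    using carr by (intro finprod_multf) auto
  also have "(\<Otimes>t\<in>f ` S. if f x = t then t [^] ?s else \<one>) = f x [^] ?s"
    using carr S x by (intro finprod_singleton) auto
  also have "f x [^] ?s = (if b then f x else inv f x)"
    using x by (simp add: int_pow_neg)
  also have "(\<Otimes>t\<in>f ` S. t [^] ?d t) = eval_word G f w" using Cons by simp
  finally show ?case by (simp add: eval_word_def a)
qed

lemma (in group) eval_word_in_generate:
  assumes "w \<in> words S"
  shows "eval_word G f w \<in> generate G (f ` S)"
  using assms
proof (induction w)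
  case Nil
  show ?case by (simp add: eval_word_def generate.one)
next
  case (Cons a w)
  obtain x b where a: "a = (x, b)" by (cases a)
  have "(if b then f x else inv f x) \<in> generate G (f ` S)"
    using Cons.prems a by (auto intro: generate.incl generate.inv)
  then show ?case using Cons a by (auto simp: eval_word_def intro: generate.eng)
qed

lemma (in group) hom_eq_on_generate:
  assumes H: "group H" and h: "h \<in> hom G H" and k: "k \<in> hom G H"
    and S: "S \<subseteq> carrier G" "\<And>s. s \<in> S \<Longrightarrow> h s = k s" and g: "g \<in> generate G S"
  shows "h g = k g"
proof -
  interpret h: group_hom G H h by (rule group_hom.intro[OF is_group H group_hom_axioms.intro[OF h]])
  interpret k: group_hom G H k by (rule group_hom.intro[OF is_group H group_hom_axioms.intro[OF k]])
  show ?thesis using g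
  proof (induction rule: generate.induct)
    case (eng a b)
    then show ?case using generate_in_carrier[OF S(1)] by simp
  qed (use S in \<open>auto simp: subset_iff\<close>)
qed

section \<open>Commuting elements and the center of a group\<close>

lemma (in group) inv_commute:
  assumes s: "s \<in> carrier G" and z: "z \<in> carrier G" and sz: "s \<otimes> z = z \<otimes> s"
  shows "inv s \<otimes> z = z \<otimes> inv s"
proof -
  have "inv s \<otimes> z = inv s \<otimes> (z \<otimes> s) \<otimes> inv s" using s z by (simp add: m_assoc)
  also have "z \<otimes> s = s \<otimes> z" using sz ..
  also have "inv s \<otimes> (s \<otimes> z) = z" using s z by (simp flip: m_assoc)
  finally show ?thesis .
qed

lemma (in group) commutes_with_generate:
  assumes S: "S \<subseteq> carrier G" and z: "z \<in> carrier G" "\<And>s. s \<in> S \<Longrightarrow> s \<otimes> z = z \<otimes> s"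
    and g: "g \<in> generate G S"
  shows "g \<otimes> z = z \<otimes> g"
  using g
proof (induction rule: generate.induct)
  case one
  show ?case using z by simp
next
  case (incl s)
  then show ?case by (rule z(2))
next
  case (inv s)
  then have "s \<in> carrier G" using S by auto
  then show ?case using z inv by (intro inv_commute)
next
  case (eng a b)
  then have "a \<in> carrier G" "b \<in> carrier G" using generate_in_carrier[OF S] by auto
  then show ?case using z(1) eng.IH by (metis m_assoc)
qed

definition center :: "('a, 'm) monoid_scheme \<Rightarrow> 'a set"
  where "center G = {z \<in> carrier G. \<forall>g\<in>carrier G. g \<otimes>\<^bsub>G\<^esub> z = z \<otimes>\<^bsub>G\<^esub> g}"

lemma center_closed: "z \<in> center G \<Longrightarrow> z \<in> carrier G"
  by (simp add: center_def)

lemma center_commute: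
  "\<lbrakk>z \<in> center G; g \<in> carrier G\<rbrakk> \<Longrightarrow> g \<otimes>\<^bsub>G\<^esub> z = z \<otimes>\<^bsub>G\<^esub> g"
  by (simp add: center_def)

lemma (in group) subgroup_center: "subgroup (center G) G"
proof (rule subgroupI)
  show "center G \<noteq> {}" by (auto simp: center_def intro!: exI[of _ \<one>])
  show "inv a \<in> center G" if "a \<in> center G" for a
    using that by (auto simp: center_def intro!: inv_commute[symmetric])
  show "a \<otimes> b \<in> center G" if "a \<in> center G" "b \<in> center G" for a b
  proof -
    have c: "a \<in> carrier G" "b \<in> carrier G" using that by (simp_all add: center_closed)
    have "g \<otimes> (a \<otimes> b) = a \<otimes> b \<otimes> g" if g: "g \<in> carrier G" for g
    proof -
      have "g \<otimes> (a \<otimes> b) = a \<otimes> g \<otimes> b"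
        using c g center_commute[OF \<open>a \<in> center G\<close> g] by (simp flip: m_assoc)
      also have "\<dots> = a \<otimes> b \<otimes> g"
        using c g center_commute[OF \<open>b \<in> center G\<close> g] by (simp add: m_assoc)
      finally show ?thesis .
    qed
    then show ?thesis unfolding center_def using c by simp
  qed
qed (auto intro: center_closed)

lemma (in group) comm_group_center: "comm_group (G\<lparr>carrier := center G\<rparr>)"
proof -
  interpret Z: group "G\<lparr>carrier := center G\<rparr>"
    by (rule subgroup_imp_group[OF subgroup_center])
  show ?thesis by (rule Z.group_comm_groupI) (simp add: center_commute center_closed)
qed

lemma (in group) normal_of_subset_center:
  assumes "subgroup A G" "A \<subseteq> center G"
  shows "A \<lhd> G"
proof (rule normalI[OF assms(1)], rule ballI)
  fix x assume x: "x \<in> carrier G"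
  have "a \<otimes> x = x \<otimes> a" if "a \<in> A" for a
    using center_commute[of a G x] assms(2) that x by auto
  then show "A #> x = x <# A" unfolding r_coset_def l_coset_def by simp
qed

section \<open>Generators of a presented group\<close>

lemma carrier_presented_group:
  "carrier (presented_group S R) = (\<lambda>w. pres_rel S R `` {w}) ` words S"
  by (auto simp: presented_group_def quotient_def)

text \<open>Evaluation multiplies the classes of the letters. The content is that the class of
  \<open>[(x, False)]\<close> is the inverse of that of \<open>[(x, True)]\<close>, which is an
  instance of \<open>cancel\<close>.\<close>

lemma eval_word_presented_group:
  assumes "w \<in> words S"
  shows "eval_word (presented_group S R) (\<lambda>x. pres_rel S R `` {[(x, True)]}) w = pres_rel S R `` {w}"
  using assms
proof (induction w)
  case Nil
  show ?case by (simp add: eval_word_def presented_group_def)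
next
  case (Cons a w)
  interpret group "presented_group S R" by (rule presented_group_is_group)
  obtain x b where a: "a = (x, b)" by (cases a)
  have x: "x \<in> S" using Cons.prems a by simp
  have "pres_rel S R `` {[(x, False)]} \<otimes>\<^bsub>presented_group S R\<^esub> pres_rel S R `` {[(x, True)]}
      = pres_rel S R `` {[(x, False), (x, True)]}"
    using x by (simp add: presented_group_mult)
  also have "\<dots> = pres_rel S R `` {[]}"
    using pres_rel.cancel[of "[]" S "[]" x False R] x
    by (intro equiv_class_eq[OF equiv_pres_rel]) simp
  also have "\<dots> = \<one>\<^bsub>presented_group S R\<^esub>" by (simp add: presented_group_def)
  finally have "inv\<^bsub>presented_group S R\<^esub> (pres_rel S R `` {[(x, True)]}) = pres_rel S R `` {[(x, False)]}"
    using x by (intro inv_equality) (simp_all add: carrier_presented_group)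
  then have "eval_word (presented_group S R) (\<lambda>x. pres_rel S R `` {[(x, True)]}) (a # w)
      = pres_rel S R `` {[(x, b)]} \<otimes>\<^bsub>presented_group S R\<^esub> pres_rel S R `` {w}"
    using Cons by (simp add: eval_word_def a)
  then show ?case using Cons.prems a by (simp add: presented_group_mult)
qed

lemma generate_presented_group:
  "generate (presented_group S R) ((\<lambda>x. pres_rel S R `` {[(x, True)]}) ` S) =
    carrier (presented_group S R)"
proof -
  interpret group "presented_group S R" by (rule presented_group_is_group)
  let ?g = "\<lambda>x. pres_rel S R `` {[(x, True)]}"
  show ?thesis
  proof
    show "generate (presented_group S R) (?g ` S) \<subseteq> carrier (presented_group S R)"
      by (rule generate_incl) (auto simp: carrier_presented_group)
    show "carrier (presented_group S R) \<subseteq> generate (presented_group S R) (?g ` S)"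
    proof
      fix g assume "g \<in> carrier (presented_group S R)"
      then obtain w where w: "w \<in> words S" "g = pres_rel S R `` {w}"
        unfolding carrier_presented_group by blast
      show "g \<in> generate (presented_group S R) (?g ` S)"
        using eval_word_in_generate[OF w(1), of ?g]
        by (simp only: eval_word_presented_group[OF w(1)] w(2))
    qed
  qed
qed

section \<open>Enveloping groups of quandles\<close>

lemma bij_betw_finite_funpow_eq_id:
  assumes "finite A" "bij_betw f A A"
  shows "\<exists>n>0. \<forall>y\<in>A. (f ^^ n) y = y"
proof -
  \<comment> \<open>Outside \<open>A\<close> nothing is known about \<open>f\<close>; extending by
    the identity gives a permutation of a finite set, some positive power of which is
    \<open>id\<close>.\<close>
  let ?p = "\<lambda>y. if y \<in> A then f y else y"
  have "bij_betw ?p A A"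
    using bij_betw_cong[of A ?p f A] assms(2) by simp
  then have "?p permutes A" by (intro bij_imp_permutes) auto
  then have "permutation ?p" using assms(1) by (auto simp: permutation_permutes)
  then obtain n where n: "?p ^^ n = id" "n > 0" using permutation_is_nilpotent by blast
  have p: "(?p ^^ k) y = (f ^^ k) y \<and> (f ^^ k) y \<in> A" if "y \<in> A" for k y
    using that assms(2) by (induction k) (auto simp: bij_betw_def)
  have "(f ^^ n) y = y" if "y \<in> A" for y
    using p[OF that, of n] n(1) by simp
  with n(2) show ?thesis by blast
qed

context quandle
begin

lemma bij_betw_tri: "x \<in> Q \<Longrightarrow> bij_betw ((\<rhd>) x) Q Q"
  unfolding bij_betw_def
proof
  assume x: "x \<in> Q"
  show "inj_on ((\<rhd>) x) Q"
  proof (rule inj_onI)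
    fix y z assume "y \<in> Q" "z \<in> Q" "x \<rhd> y = x \<rhd> z"
    then show "y = z" using unique_solution[OF x closed[OF x \<open>z \<in> Q\<close>]] by blast
  qed
  show "(\<rhd>) x ` Q = Q"
  proof
    show "(\<rhd>) x ` Q \<subseteq> Q" using closed[OF x] by blast
    show "Q \<subseteq> (\<rhd>) x ` Q"
    proof
      fix y assume "y \<in> Q"
      then obtain z where "z \<in> Q" "x \<rhd> z = y" using unique_solution[OF x] by blast
      then show "y \<in> (\<rhd>) x ` Q" by blast
    qed
  qed
qed

lemma tri_funpow_eq_id:
  assumes "finite Q"
  shows "\<exists>N>0. \<forall>x\<in>Q. \<forall>y\<in>Q. ((\<rhd>) x ^^ N) y = y"
proof -
  obtain n where n: "\<And>x. x \<in> Q \<Longrightarrow> n x > (0::nat)"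
    "\<And>x y. \<lbrakk>x \<in> Q; y \<in> Q\<rbrakk> \<Longrightarrow> ((\<rhd>) x ^^ n x) y = y"
    using bij_betw_finite_funpow_eq_id[OF assms bij_betw_tri] by metis
  \<comment> \<open>The product of the exponents \<open>n x\<close> is a multiple of each of them,
    hence works for all left translations at once.\<close>
  have "((\<rhd>) x ^^ (\<Prod>x\<in>Q. n x)) y = y" if xy: "x \<in> Q" "y \<in> Q" for x y
  proof -
    obtain k where "(\<Prod>x\<in>Q. n x) = n x * k"
      using dvd_prodI[OF assms xy(1)] by (metis dvdE)
    moreover have "(((\<rhd>) x ^^ n x) ^^ k) y = y" using n(2)[OF xy] by (induction k) auto
    ultimately show ?thesis by (simp add: funpow_mult)
  qed
  then show ?thesis using n(1) by (intro exI[of _ "\<Prod>x\<in>Q. n x"]) (auto intro: prod_pos)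
qed

section \<open>Conjugation relations among the generators\<close>

definition rels :: "('a word \<times> 'a word) set"
  where "rels = {([(x, True), (y, True), (x, False)], [(x \<rhd> y, True)]) | x y. x \<in> Q \<and> y \<in> Q}"

definition gen :: "'a \<Rightarrow> 'a word set"
  where "gen x = pres_rel Q rels `` {[(x, True)]}"

lemma enveloping_group_eq: "enveloping_group Q (\<rhd>) = presented_group Q rels"
  by (simp add: enveloping_group_def rels_def)

sublocale G: group "enveloping_group Q (\<rhd>)"
  unfolding enveloping_group_eq by (rule presented_group_is_group)

abbreviation G where "G \<equiv> enveloping_group Q (\<rhd>)"

lemma gen_closed [simp]: "x \<in> Q \<Longrightarrow> gen x \<in> carrier G"
  by (auto simp: gen_def enveloping_group_eq carrier_presented_group)

lemma generate_gen: "generate G (gen ` Q) = carrier G"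
  unfolding enveloping_group_eq gen_def by (rule generate_presented_group)

lemma gen_conj:
  assumes xy: "x \<in> Q" "y \<in> Q"
  shows "gen x \<otimes>\<^bsub>G\<^esub> gen y \<otimes>\<^bsub>G\<^esub> inv\<^bsub>G\<^esub> gen x = gen (x \<rhd> y)"
proof -
  let ?u = "[(x, True), (y, True), (x, False)]"
  have "(?u, [(x \<rhd> y, True)]) \<in> rels" unfolding rels_def using xy by blast
  then have "([] @ ?u @ [], [] @ [(x \<rhd> y, True)] @ []) \<in> pres_rel Q rels"
    by (intro pres_rel.relation) (use xy closed in simp_all)
  then have "(?u, [(x \<rhd> y, True)]) \<in> pres_rel Q rels" by simp
  then have "gen (x \<rhd> y) = pres_rel Q rels `` {?u}"
    unfolding gen_def by (rule equiv_class_eq[OF equiv_pres_rel pres_rel.sym])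
  also have "\<dots> = eval_word G gen ?u"
    using xy eval_word_presented_group[of ?u Q rels]
    by (simp add: enveloping_group_eq gen_def[abs_def])
  also have "\<dots> = gen x \<otimes>\<^bsub>G\<^esub> gen y \<otimes>\<^bsub>G\<^esub> inv\<^bsub>G\<^esub> gen x"
    using xy by (simp add: eval_word_def G.m_assoc)
  finally show ?thesis ..
qed

lemma gen_push:
  assumes "x \<in> Q" "y \<in> Q"
  shows "gen x \<otimes>\<^bsub>G\<^esub> gen y = gen (x \<rhd> y) \<otimes>\<^bsub>G\<^esub> gen x"
  using assms by (simp add: G.m_assoc closed flip: gen_conj)

text \<open>Iterates \<open>gen_push\<close>. At an \<open>n\<close> for which the power of the left
  translation is the identity, it says that this power of \<open>gen x\<close> commutes with
  \<open>gen y\<close>.\<close>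

lemma gen_pow_push:
  assumes "x \<in> Q" "y \<in> Q"
  shows "gen x [^]\<^bsub>G\<^esub> (n::nat) \<otimes>\<^bsub>G\<^esub> gen y = gen (((\<rhd>) x ^^ n) y) \<otimes>\<^bsub>G\<^esub> gen x [^]\<^bsub>G\<^esub> n"
  using assms(2)
proof (induction n arbitrary: y)
  case 0
  then show ?case by simp
next
  case (Suc n)
  have c: "((\<rhd>) x ^^ n) (x \<rhd> y) \<in> Q" using assms(1) Suc.prems
    by (induction n) (auto simp: closed)
  have "gen x [^]\<^bsub>G\<^esub> Suc n \<otimes>\<^bsub>G\<^esub> gen y = gen x [^]\<^bsub>G\<^esub> n \<otimes>\<^bsub>G\<^esub> gen (x \<rhd> y) \<otimes>\<^bsub>G\<^esub> gen x"
    using assms(1) Suc.prems closed gen_push[OF assms(1) Suc.prems] by (simp add: G.m_assoc)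
  also have "\<dots> = gen (((\<rhd>) x ^^ n) (x \<rhd> y)) \<otimes>\<^bsub>G\<^esub> gen x [^]\<^bsub>G\<^esub> Suc n"
    using assms(1) Suc.IH[of "x \<rhd> y"] Suc.prems closed c by (simp add: G.m_assoc)
  finally show ?case by (simp add: funpow_swap1)
qed

text \<open>Conjugation by \<open>gen x\<close> is an automorphism, so it carries powers of
  \<open>gen y\<close> to powers of \<open>gen (x \<rhd> y)\<close>. This is what makes central
  powers of generators constant on orbits.\<close>

lemma gen_push_pow:
  assumes xy: "x \<in> Q" "y \<in> Q"
  shows "gen x \<otimes>\<^bsub>G\<^esub> gen y [^]\<^bsub>G\<^esub> (n::nat) = gen (x \<rhd> y) [^]\<^bsub>G\<^esub> n \<otimes>\<^bsub>G\<^esub> gen x"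
proof (induction n)
  case 0
  then show ?case using xy by simp
next
  case (Suc n)
  have "gen x \<otimes>\<^bsub>G\<^esub> gen y [^]\<^bsub>G\<^esub> Suc n = gen (x \<rhd> y) [^]\<^bsub>G\<^esub> n \<otimes>\<^bsub>G\<^esub> (gen x \<otimes>\<^bsub>G\<^esub> gen y)"
    using xy closed Suc by (simp flip: G.m_assoc)
  then show ?case using xy closed by (simp add: G.m_assoc gen_push[OF xy])
qed

text \<open>In a commutative target the relation for \<open>x\<close> and \<open>y\<close> collapses
  to \<open>f y = f (x \<rhd> y)\<close>, so a map constant on orbits extends. Both the power map
  and the degrees arise this way.\<close>

lemma enveloping_group_hom_comm_group:
  assumes H: "comm_group H" and f: "f \<in> Q \<rightarrow> carrier H"
    and const: "\<And>x y. \<lbrakk>x \<in> Q; y \<in> Q\<rbrakk> \<Longrightarrow> f (x \<rhd> y) = f y"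
  shows "\<exists>h \<in> hom G H. \<forall>w \<in> words Q. h (pres_rel Q rels `` {w}) = eval_word H f w"
proof -
  interpret H: comm_group H by (rule H)
  have "eval_word H f r = eval_word H f s" if rs: "(r, s) \<in> rels" for r s
  proof -
    obtain x y where xy: "r = [(x, True), (y, True), (x, False)]" "s = [(x \<rhd> y, True)]"
      "x \<in> Q" "y \<in> Q" using rs by (auto simp: rels_def)
    then have "f x \<in> carrier H" "f y \<in> carrier H" using f by auto
    then show ?thesis using xy const by (simp add: eval_word_def H.m_lcomm[of "f x" "f y"])
  qed
  then show ?thesis
    using H.presented_group_universal[OF f] by (simp add: enveloping_group_eq)
qed

end

section \<open>The power map, the degrees and the faithful representation\<close>

lemma (in quandle) faithful_unitary_rep_enveloping_group:
  assumes fin: "finite Q"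
  shows "\<exists>n. \<exists>\<rho> \<in> hom G (unitary_group n). inj_on \<rho> (carrier G)"
proof -
  obtain N where N: "N > 0" and tri_N: "\<And>x y. \<lbrakk>x \<in> Q; y \<in> Q\<rbrakk> \<Longrightarrow> ((\<rhd>) x ^^ N) y = y"
    using tri_funpow_eq_id[OF fin] by blast
  define f where "f x = gen x [^]\<^bsub>G\<^esub> N" for x
  have f_closed: "f x \<in> carrier G" if "x \<in> Q" for x
    using that by (simp add: f_def)
  have f_center: "f x \<in> center G" if x: "x \<in> Q" for x
  proof -
    have comm: "s \<otimes>\<^bsub>G\<^esub> f x = f x \<otimes>\<^bsub>G\<^esub> s" if "s \<in> gen ` Q" for s
    proof -
      obtain y where y: "y \<in> Q" "s = gen y" using \<open>s \<in> gen ` Q\<close> by blast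
      \<comment> \<open>The \<open>N\<close>-th power of the left translation is the identity, so
        \<open>f x\<close> moves past a generator unchanged.\<close>
      show ?thesis using gen_pow_push[OF x y(1), of N] tri_N[OF x y(1)] y(2) by (simp add: f_def)
    qed
    have "g \<otimes>\<^bsub>G\<^esub> f x = f x \<otimes>\<^bsub>G\<^esub> g" if "g \<in> carrier G" for g
    proof (rule G.commutes_with_generate[OF _ f_closed[OF x] comm])
      show "gen ` Q \<subseteq> carrier G" by auto
      show "g \<in> generate G (gen ` Q)" using that by (simp only: generate_gen)
    qed
    then show ?thesis unfolding center_def using f_closed[OF x] by blast
  qed
  have f_const: "f (x \<rhd> y) = f y" if xy: "x \<in> Q" "y \<in> Q" for x y
  proof -
    \<comment> \<open>Conjugation by \<open>gen x\<close> turns \<open>f y\<close> into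
      \<open>f (x \<rhd> y)\<close>, but fixes it because it is central.\<close>
    have "f (x \<rhd> y) \<otimes>\<^bsub>G\<^esub> gen x = gen x \<otimes>\<^bsub>G\<^esub> f y"
      unfolding f_def by (rule gen_push_pow[OF xy, symmetric])
    also have "\<dots> = f y \<otimes>\<^bsub>G\<^esub> gen x"
      by (rule center_commute[OF f_center[OF xy(2)] gen_closed[OF xy(1)]])
    finally show ?thesis using xy f_closed closed by simp
  qed
  define Z where "Z = G\<lparr>carrier := center G\<rparr>"
  interpret Z: comm_group Z unfolding Z_def by (rule G.comm_group_center)
  have fZ: "f \<in> Q \<rightarrow> carrier Z" using f_center by (simp add: Z_def)
  obtain \<psi> where \<psi>: "\<psi> \<in> hom G Z"
    "\<And>w. w \<in> words Q \<Longrightarrow> \<psi> (pres_rel Q rels `` {w}) = eval_word Z f w"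
    using enveloping_group_hom_comm_group[OF Z.comm_group_axioms fZ f_const] by blast
  \<comment> \<open>As \<open>f\<close> is constant on orbits, so is the indicator of
    \<open>f x = t\<close>; the homomorphism it induces is the degree at \<open>t\<close>.\<close>
  have "\<exists>d \<in> hom G integer_group. \<forall>w \<in> words Q.
      d (pres_rel Q rels `` {w}) = eval_word integer_group (\<lambda>x. of_bool (f x = t)) w" for t
    by (rule enveloping_group_hom_comm_group[OF abelian_integer_group]) (simp_all add: f_const)
  then obtain d where d: "\<And>t. d t \<in> hom G integer_group"
    "\<And>t w. w \<in> words Q \<Longrightarrow>
      d t (pres_rel Q rels `` {w}) = eval_word integer_group (\<lambda>x. of_bool (f x = t)) w"
    by metis
  have \<psi>G: "\<psi> \<in> hom G G"
    using \<psi>(1) by (auto simp: hom_def Z_def Pi_iff intro!: center_closed)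
  have \<psi>_gen: "\<psi> (gen x) = f x" if "x \<in> Q" for x
    using \<psi>(2)[of "[(x, True)]"] that Z.r_one[OF funcset_mem[OF fZ that]]
    by (simp add: gen_def eval_word_def)
  have \<psi>_one: "\<psi> g = \<one>\<^bsub>G\<^esub>" if g: "g \<in> carrier G" and dg: "\<And>t. t \<in> f ` Q \<Longrightarrow> d t g = 0" for g
  proof -
    obtain w where w: "w \<in> words Q" "g = pres_rel Q rels `` {w}"
      using g by (auto simp: enveloping_group_eq carrier_presented_group)
    have "\<psi> g = (\<Otimes>\<^bsub>Z\<^esub>t\<in>f ` Q. t [^]\<^bsub>Z\<^esub> d t g)"
      unfolding w(2) \<psi>(2)[OF w(1)] d(2)[OF w(1)] by (rule Z.eval_word_eq_finprod[OF fin fZ w(1)])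
    also have "\<dots> = \<one>\<^bsub>Z\<^esub>" using dg by (intro Z.finprod_one_eqI) simp
    finally show ?thesis by (simp add: Z_def)
  qed
  \<comment> \<open>Both sides are homomorphisms in \<open>g\<close>, so generators suffice, and
    there \<psi> raises \<open>gen x\<close> to its \<open>N\<close>-th power.\<close>
  have d_\<psi>: "d t (\<psi> g) = int N * d t g" if g: "g \<in> carrier G" for t g
  proof (rule G.hom_eq_on_generate[where h = "\<lambda>g. d t (\<psi> g)" and k = "\<lambda>g. int N * d t g"
        and S = "gen ` Q" and H = integer_group])
    show "(\<lambda>g. d t (\<psi> g)) \<in> hom G integer_group"
      using d(1)[of t] \<psi>G by (auto simp: hom_def Pi_iff)
    show "(\<lambda>g. int N * d t g) \<in> hom G integer_group"
      using d(1)[of t] by (auto simp: hom_def algebra_simps)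
    show "d t (\<psi> s) = int N * d t s" if "s \<in> gen ` Q" for s
    proof -
      obtain x where x: "x \<in> Q" "s = gen x" using \<open>s \<in> gen ` Q\<close> by blast
      have "d t (gen x [^]\<^bsub>G\<^esub> N) = d t (gen x) [^]\<^bsub>integer_group\<^esub> N"
        by (rule hom_nat_pow[OF d(1) gen_closed[OF x(1)] G.is_group group_integer_group])
      then show ?thesis using x by (simp add: \<psi>_gen f_def)
    qed
    show "gen ` Q \<subseteq> carrier G" by auto
    show "g \<in> generate G (gen ` Q)" using g by (simp only: generate_gen)
  qed simp
  define A where "A = \<psi> ` carrier G"
  interpret \<psi>: group_hom G G \<psi> by unfold_locales (rule \<psi>G)
  have "A \<lhd> G"
    unfolding A_def using \<psi>(1)
    by (intro G.normal_of_subset_center \<psi>.img_is_subgroup) (auto simp: hom_def Z_def)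
  then interpret A: normal A G .
  interpret Q: group "G Mod A" by (rule A.factorgroup_is_group)
  let ?\<phi> = "\<lambda>g. A #>\<^bsub>G\<^esub> g"
  interpret \<phi>: group_hom G "G Mod A" ?\<phi> by unfold_locales (rule A.r_coset_hom_Mod)
  have "finite (carrier (G Mod A))"
  proof (rule Q.dietzmann)
    show "?\<phi> ` gen ` Q \<subseteq> carrier (G Mod A)" using \<phi>.hom_closed by auto
    show "finite (?\<phi> ` gen ` Q)" using fin by blast
    show "N > 0" by (rule N)
    show "generate (G Mod A) (?\<phi> ` gen ` Q) = carrier (G Mod A)"
    proof -
      have "generate (G Mod A) (?\<phi> ` gen ` Q) = ?\<phi> ` carrier G"
        using \<phi>.generate_img[of "gen ` Q"] by (simp add: generate_gen image_subset_iff)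
      then show ?thesis by (auto simp: FactGroup_def RCOSETS_def)
    qed
  next
    fix s assume "s \<in> ?\<phi> ` gen ` Q"
    then obtain x where x: "x \<in> Q" "s = ?\<phi> (gen x)" by blast
    \<comment> \<open>The \<open>N\<close>-th power of \<open>gen x\<close> is its image under
      \<psi>, so it dies in the quotient; this is the torsion that \<open>dietzmann\<close>
      requires.\<close>
    have "f x \<in> A" unfolding A_def using x(1) \<psi>_gen by (metis gen_closed imageI)
    then have "?\<phi> (f x) = \<one>\<^bsub>G Mod A\<^esub>"
      using G.coset_join2[OF f_closed[OF x(1)] A.subgroup_axioms] by simp
    then show "s [^]\<^bsub>G Mod A\<^esub> N = \<one>\<^bsub>G Mod A\<^esub>"
      using x \<phi>.hom_nat_pow[OF gen_closed[OF x(1)], of N] by (simp add: f_def)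
    fix t assume "t \<in> ?\<phi> ` gen ` Q"
    then obtain y where y: "y \<in> Q" "t = ?\<phi> (gen y)" by blast
    have "s \<otimes>\<^bsub>G Mod A\<^esub> t \<otimes>\<^bsub>G Mod A\<^esub> inv\<^bsub>G Mod A\<^esub> s
        = ?\<phi> (gen x \<otimes>\<^bsub>G\<^esub> gen y \<otimes>\<^bsub>G\<^esub> inv\<^bsub>G\<^esub> gen x)"
      using x y by (simp only: \<phi>.hom_mult \<phi>.hom_inv gen_closed G.m_closed G.inv_closed)
    then show "s \<otimes>\<^bsub>G Mod A\<^esub> t \<otimes>\<^bsub>G Mod A\<^esub> inv\<^bsub>G Mod A\<^esub> s \<in> ?\<phi> ` gen ` Q"
      using x y closed by (auto simp: gen_conj)
  qed
  then show ?thesis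
  proof (rule G.unitary_rep_of_finite_quotient_and_degrees[OF Q.is_group _ \<phi>.homh])
    \<comment> \<open>Adjoining \<open>\<one>\<close> keeps the index set nonempty when \<open>Q\<close> is empty.\<close>
    show "finite (insert \<one>\<^bsub>G\<^esub> (f ` Q))" "insert \<one>\<^bsub>G\<^esub> (f ` Q) \<noteq> {}" using fin by auto
    show "d t \<in> hom G integer_group" for t by (rule d(1))
    fix g assume g: "g \<in> carrier G" "?\<phi> g = \<one>\<^bsub>G Mod A\<^esub>"
      and dg: "\<And>t. t \<in> insert \<one>\<^bsub>G\<^esub> (f ` Q) \<Longrightarrow> d t g = 0"
    have "g \<in> A" using g G.coset_join1[OF _ g(1) A.subgroup_axioms] by simp
    then obtain u where u: "u \<in> carrier G" "g = \<psi> u" unfolding A_def by blast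
    \<comment> \<open>By \<open>d_\<psi>\<close> the degree of \<open>g\<close> at \<open>t\<close>
      is \<open>N\<close> times that of the preimage \<open>u\<close>, and \<open>N > 0\<close>. So
      the degrees of \<open>u\<close> vanish, which forces \<open>\<psi> u\<close> to be
      trivial.\<close>
    have "d t u = 0" if "t \<in> f ` Q" for t
      using dg[of t] that N d_\<psi>[OF u(1)] u(2) by simp
    then show "g = \<one>\<^bsub>G\<^esub>" using \<psi>_one[OF u(1)] u(2) by simp
  qed
qed

theorem theorem4p2:
  fixes Q :: "'a set" and tri :: "'a \<Rightarrow> 'a \<Rightarrow> 'a"
  assumes "quandle Q tri" and "finite Q"
  shows "\<exists>n. \<exists>\<rho> \<in> hom (enveloping_group Q tri) (unitary_group n).
           inj_on \<rho> (carrier (enveloping_group Q tri))"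
  using quandle.faithful_unitary_rep_enveloping_group[OF assms] .

end
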